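(* For any (finite) graph $G=(V,E)$ with $V=[n]$, the polynomial $$f_G(\mathbf{1},w)=\det(L(G)+I)=\sum_{F}\omega_G(F)\,w^F$$ in the edge variables $w=(w_e)_{e\in E}$ is real stable. Here the sum is over all spanning forests $F\subseteq E$ of $G$ and $\omega_G(F)$ is the product of the sizes of the connected components of $(V,F)$.
   Context: Let $[n]=\{1,\dots,n\}$ and let $G=(V,E)$ be a graph with vertex set $V=[n]$ and edge set $E$. Associate to each edge $e\in E$ a variable $w_e$. If $e$ connects $i$ and $j$, let $A_e$ be the $n\times n$ matrix with $ii$- and $jj$-entries equal to $1$, $ij$- and $ji$-entries equal to $-1$, and all other entries $0$. The Laplacian of $G$ is $L(G)=\sum_{e\in E}w_eA_e$. Put $f_G(z,w)=\det(L(G)+Z)$ with $Z=\mathrm{diag}(z_1,\dots,z_n)$; $\mathbf{1}=(1,\dots,1)$. A spanning forest is an edge set $F\subseteq E$ such that $(V,F)$ contains no cycle (isolated vertices are connected components of size 1), and $w^F=\prod_{e\in F}w_e$. By the Principal Minors Matrix-Tree Theorem $f_G(\mathbf{1},w)=\sum_F\omega_G(F)w^F$. A polynomial $f\in\mathbb{C}[x_1,\dots,x_m]$ is stable if $f(x_1,\dots,x_m)\ne0$ whenever $\mathrm{Im}(x_j)>0$ for all $j$; it is real stable if in addition all its coefficients are real. *)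

theory Defs
  imports
    "HOL-Library.Poly_Mapping"
    "Jordan_Normal_Form.Determinant"
begin

text \<open>A monomial is a finitely supported exponent function, and a polynomial is a finitely
  supported coefficient function on monomials; the ring structure comes from
  \<^theory>\<open>HOL-Library.Poly_Mapping\<close>.\<close>

type_synonym 'v cpoly = "('v \<Rightarrow>\<^sub>0 nat) \<Rightarrow>\<^sub>0 complex"

definition Var :: "'v \<Rightarrow> 'v cpoly" where
  "Var v = Poly_Mapping.single (Poly_Mapping.single v 1) 1"

definition poly_eval :: "('v \<Rightarrow> complex) \<Rightarrow> 'v cpoly \<Rightarrow> complex" where
  "poly_eval x p =
     (\<Sum>m\<in>Poly_Mapping.keys p. Poly_Mapping.lookup p m *
        (\<Prod>v\<in>Poly_Mapping.keys m. x v ^ Poly_Mapping.lookup m v))"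

text \<open>Stability refers to the polynomial ring \<open>\<complex>[x\<^sub>v : v \<in> S]\<close>: only variables from \<open>S\<close> may occur,
  and only these are required to have positive imaginary part.\<close>

definition stable :: "'v set \<Rightarrow> 'v cpoly \<Rightarrow> bool" where
  "stable S p \<longleftrightarrow>
     (\<forall>m\<in>Poly_Mapping.keys p. Poly_Mapping.keys m \<subseteq> S) \<and>
     (\<forall>x. (\<forall>v\<in>S. Im (x v) > 0) \<longrightarrow> poly_eval x p \<noteq> 0)"

definition real_stable :: "'v set \<Rightarrow> 'v cpoly \<Rightarrow> bool" where
  "real_stable S p \<longleftrightarrow> stable S p \<and> (\<forall>m. Poly_Mapping.lookup p m \<in> \<real>)"

text \<open>A finite graph on the vertex set \<open>V\<close> has edge set \<open>E\<close>, and \<open>ends e\<close> is the set of the two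
  distinct vertices connected by \<open>e\<close>. Parallel edges are allowed; simple graphs are the case
  where \<open>ends\<close> is injective on \<open>E\<close>.\<close>

definition graph :: "'v set \<Rightarrow> 'e set \<Rightarrow> ('e \<Rightarrow> 'v set) \<Rightarrow> bool" where
  "graph V E ends \<longleftrightarrow>
     finite V \<and> finite E \<and> (\<forall>e\<in>E. ends e \<subseteq> V \<and> card (ends e) = 2)"

text \<open>The cycle \<open>vs!0, es!0, vs!1, es!1, \<dots>\<close>, closing up at \<open>vs!0\<close>. Two parallel edges form a
  cycle of length 2.\<close>

definition is_cycle :: "('e \<Rightarrow> 'v set) \<Rightarrow> 'e set \<Rightarrow> 'v list \<Rightarrow> 'e list \<Rightarrow> bool" where
  "is_cycle ends F vs es \<longleftrightarrow>
     es \<noteq> [] \<and> length vs = length es \<and> distinct vs \<and> distinct es \<and> set es \<subseteq> F \<and>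
     (\<forall>i<length es. ends (es ! i) = {vs ! i, vs ! (Suc i mod length es)})"

definition spanning_forests :: "'e set \<Rightarrow> ('e \<Rightarrow> 'v set) \<Rightarrow> 'e set set" where
  "spanning_forests E ends = {F. F \<subseteq> E \<and> (\<nexists>vs es. is_cycle ends F vs es)}"

definition connected_rel :: "'v set \<Rightarrow> ('e \<Rightarrow> 'v set) \<Rightarrow> 'e set \<Rightarrow> ('v \<times> 'v) set" where
  "connected_rel V ends F = {(u, v). \<exists>e\<in>F. ends e = {u, v}}\<^sup>* \<inter> V \<times> V"

definition components :: "'v set \<Rightarrow> ('e \<Rightarrow> 'v set) \<Rightarrow> 'e set \<Rightarrow> 'v set set" where
  "components V ends F = V // connected_rel V ends F"

definition forest_weight :: "'v set \<Rightarrow> ('e \<Rightarrow> 'v set) \<Rightarrow> 'e set \<Rightarrow> nat" where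
  "forest_weight V ends F = (\<Prod>C\<in>components V ends F. card C)"

text \<open>The vertex set is \<open>{1..n}\<close>, whereas matrix indices start at 0: row and column \<open>i\<close> belong
  to the vertex \<open>Suc i\<close>.\<close>

definition edge_mat :: "nat \<Rightarrow> nat set \<Rightarrow> 'a::comm_ring_1 mat" where
  "edge_mat n P = mat n n (\<lambda>(i, j).
     if i = j then (if Suc i \<in> P then 1 else 0)
     else (if P = {Suc i, Suc j} then - 1 else 0))"

definition laplacian :: "nat \<Rightarrow> 'e set \<Rightarrow> ('e \<Rightarrow> nat set) \<Rightarrow> 'e cpoly mat" where
  "laplacian n E ends =
     mat n n (\<lambda>(i, j). \<Sum>e\<in>E. Var e * edge_mat n (ends e) $$ (i, j))"

text \<open>\<open>f\<^sub>G(z, w)\<close>, where the \<open>w\<^sub>e\<close> are the variables and \<open>z\<^sub>1, \<dots>, z\<^sub>n\<close> are elements of the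
  polynomial ring.\<close>

definition graph_poly ::
  "nat \<Rightarrow> 'e set \<Rightarrow> ('e \<Rightarrow> nat set) \<Rightarrow> (nat \<Rightarrow> 'e cpoly) \<Rightarrow> 'e cpoly" where
  "graph_poly n E ends z =
     det (laplacian n E ends + mat_diag n (\<lambda>i. z (Suc i)))"

end

theory Submission
  imports Defs
begin

text \<open>Orient every edge and let \<open>v\<^sub>e\<close> be the difference of the indicators of its two ends, so that
  \<open>L(G) + I = I + \<Sum>\<^sub>e w\<^sub>e v\<^sub>e v\<^sub>e\<^sup>T\<close>. The determinant is affine in each \<open>w\<^sub>e\<close>, and after adding one
  row and one column to another, its \<open>w\<^sub>e\<close>-coefficient is seen to be the determinant for the graph
  in which \<open>e\<close> is contracted. Iterating this deletion-contraction step processes the edges as in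
  Kruskal's algorithm: an edge contributes to a product \<open>w\<^sup>F\<close> exactly when its ends are not yet
  connected, and the sizes of the merged vertices multiply to \<open>\<omega>\<^sub>G(F)\<close>.

  For stability, let \<open>Im w\<^sub>e > 0\<close> and let \<open>u\<close> lie in the kernel. Then
  \<open>0 = u\<^sup>* (L(G) + I) u = |u|\<^sup>2 + \<Sum>\<^sub>e w\<^sub>e |v\<^sub>e\<^sup>T u|\<^sup>2\<close>; imaginary parts give \<open>v\<^sub>e\<^sup>T u = 0\<close> for all \<open>e\<close>,
  hence \<open>u = 0\<close>. Since the forest expansion holds over every commutative ring, it also identifies the
  values of the polynomial with determinants of complex matrices.\<close>

subsection \<open>Rank-one updates and the contracted determinant\<close>

definition gram_mat ::
  "nat \<Rightarrow> (nat \<Rightarrow> 'a) \<Rightarrow> 'e set \<Rightarrow> ('e \<Rightarrow> 'a) \<Rightarrow> ('e \<Rightarrow> nat \<Rightarrow> 'a) \<Rightarrow> 'a::comm_ring_1 mat" where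
  "gram_mat n d E w v =
     mat n n (\<lambda>(i, j). (if i = j then d i else 0) + (\<Sum>e\<in>E. w e * v e i * v e j))"

text \<open>Contraction happens in place: index \<open>s\<close> absorbs \<open>t\<close>, while
  \<open>t\<close> survives as a decoupled diagonal 1, so the size \<open>n\<close> never
  changes.\<close>

lemma det_gram_mat_insert:
  fixes d :: "nat \<Rightarrow> 'a::comm_ring_1"
  assumes "finite E" "e \<notin> E" "s < n" "t < n" "s \<noteq> t"
    and v: "\<And>i. v e i = of_bool (i = s) - of_bool (i = t)"
  shows "det (gram_mat n d (insert e E) w v) = det (gram_mat n d E w v) +
    w e * det (gram_mat n (d(s := d s + d t, t := 1)) E w
                 (\<lambda>f. (v f)(s := v f s + v f t, t := 0)))"
proof -
  \<comment> \<open>This operation sends \<open>v\<^sub>e\<close> to minus the \<open>t\<close>-th unit vector, so \<open>w e\<close> only enters at \<open>(t, t)\<close>.\<close>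
  define op where "op = (\<lambda>A :: 'a mat. addcol 1 s t (addrow 1 s t A))"
  define M where "M = gram_mat n d (insert e E) w v"
  define M0 where "M0 = gram_mat n d E w v"
  define M' where "M' = gram_mat n (d(s := d s + d t, t := 1)) E w
                 (\<lambda>f. (v f)(s := v f s + v f t, t := 0))"
  have car: "M \<in> carrier_mat n n" "M0 \<in> carrier_mat n n" "M' \<in> carrier_mat n n"
    by (auto simp: M_def M0_def M'_def gram_mat_def)
  have op_car: "op A \<in> carrier_mat n n" if "A \<in> carrier_mat n n" for A
    using that unfolding op_def mat_addcol_def by auto
  have op_det: "det (op A) = det A" if "A \<in> carrier_mat n n" for A
    using that assms unfolding op_def
    by (subst det_addcol[of _ n]) (auto simp: det_addrow[of _ n])
  have op_entry: "op A $$ (i, j) = A $$ (i, j) + (if i = s then A $$ (t, j) else 0)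
      + (if j = s then A $$ (i, t) else 0) + (if i = s \<and> j = s then A $$ (t, t) else 0)"
    if "A \<in> carrier_mat n n" "i < n" "j < n" for A i j
    using that assms unfolding op_def by (auto simp: ac_simps)
  have M_entry: "M $$ (i, j) = M0 $$ (i, j) + w e * v e i * v e j" if "i < n" "j < n" for i j
    using that assms by (simp add: M_def M0_def gram_mat_def)
  have opM: "op M $$ (i, j) = op M0 $$ (i, j) + (if i = t \<and> j = t then w e else 0)"
    if "i < n" "j < n" for i j
    using that assms car by (simp add: op_entry M_entry v algebra_simps)
  \<comment> \<open>With \<open>d t\<close> set to 1 and all vectors 0 at \<open>t\<close>, row and
    column \<open>t\<close> are those of the identity; elsewhere the merged entries at
    \<open>s\<close> are what \<open>op\<close> produces.\<close>
  have M': "M' $$ (i, j) = (if i \<noteq> t \<and> j \<noteq> t then op M0 $$ (i, j) else of_bool (i = j))"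
    if "i < n" "j < n" for i j
    using that assms car
    by (simp add: op_entry) (auto simp: M'_def M0_def gram_mat_def algebra_simps sum.distrib)
  \<comment> \<open>The two matrices differ only at \<open>(t, t)\<close>, and every cofactor along
    row \<open>t\<close> deletes that row.\<close>
  have cof: "cofactor (op M) t j = cofactor (op M0) t j" if "j < n" for j
    using that op_car[OF car(1)] op_car[OF car(2)] unfolding cofactor_def
    by (intro arg_cong2[of _ _ _ _ "(*)"] arg_cong[of _ _ det] eq_matI refl)
      (auto simp: mat_delete_def opM)
  have cof': "cofactor M' t t = cofactor (op M0) t t"
    using car op_car[OF car(2)] unfolding cofactor_def
    by (intro arg_cong2[of _ _ _ _ "(*)"] arg_cong[of _ _ det] eq_matI refl)
      (auto simp: mat_delete_def M')
  have "det M' = (\<Sum>j<n. if j = t then cofactor M' t t else 0)"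
    unfolding laplace_expansion_row[OF car(3) \<open>t < n\<close>]
    using assms by (intro sum.cong) (auto simp: M')
  hence det': "det M' = cofactor (op M0) t t" using assms cof' by simp
  have "det M = det (op M)" using op_det car by simp
  also have "\<dots> = (\<Sum>j<n. op M0 $$ (t, j) * cofactor (op M0) t j
                     + (if j = t then w e * cofactor (op M0) t t else 0))"
    unfolding laplace_expansion_row[OF op_car[OF car(1)] \<open>t < n\<close>]
    using assms by (intro sum.cong) (auto simp: opM cof algebra_simps)
  also have "\<dots> = det (op M0) + w e * det M'"
    using assms by (simp add: sum.distrib laplace_expansion_row[OF op_car[OF car(2)] \<open>t < n\<close>] det')
  finally show ?thesis using op_det car by (simp add: M_def M0_def M'_def)
qed

lemma det_gram_mat_empty: "det (gram_mat n d {} w v) = (\<Prod>i<n. d i)"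
proof -
  have "det (gram_mat n d {} w v) = prod_list (diag_mat (gram_mat n d {} w v))"
    by (rule det_upper_triangular[of _ n]) (auto simp: gram_mat_def)
  thus ?thesis by (simp add: prod_list_diag_prod gram_mat_def atLeast0LessThan)
qed

section \<open>Nonvanishing for weights in the open upper half-plane\<close>

lemma det_gram_mat_nonzero:
  fixes x :: "'e \<Rightarrow> complex"
  assumes "finite E" and v: "\<And>e i. v e i \<in> \<real>" and x: "\<And>e. e \<in> E \<Longrightarrow> Im (x e) > 0"
  shows "det (gram_mat n (\<lambda>_. 1) E x v) \<noteq> 0"
proof
  define A where "A = gram_mat n (\<lambda>_. 1) E x v"
  have A: "A \<in> carrier_mat n n" by (simp add: A_def gram_mat_def)
  assume "det (gram_mat n (\<lambda>_. 1) E x v) = 0"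
  then obtain u where u: "u \<in> carrier_vec n" "u \<noteq> 0\<^sub>v n" "A *\<^sub>v u = 0\<^sub>v n"
    using det_0_iff_vec_prod_zero_field[OF A] by (auto simp: A_def)
  define s where "s = (\<lambda>e. \<Sum>j<n. v e j * u $ j)"
  have row: "u $ i + (\<Sum>e\<in>E. x e * v e i * s e) = 0" if "i < n" for i
  proof -
    have "(A *\<^sub>v u) $ i = (\<Sum>j<n. A $$ (i, j) * u $ j)"
      using that u(1) A by (simp add: scalar_prod_def atLeast0LessThan)
    also have "\<dots> = (\<Sum>j<n. if i = j then u $ j else 0)
                    + (\<Sum>j<n. \<Sum>e\<in>E. x e * v e i * v e j * u $ j)"
      unfolding sum.distrib[symmetric] using that
      by (intro sum.cong) (auto simp: A_def gram_mat_def algebra_simps sum_distrib_left)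
    also have "(\<Sum>j<n. \<Sum>e\<in>E. x e * v e i * v e j * u $ j) = (\<Sum>e\<in>E. x e * v e i * s e)"
      by (subst sum.swap) (simp add: s_def sum_distrib_left ac_simps)
    finally show ?thesis using that u by simp
  qed
  \<comment> \<open>Because \<open>v\<close> is real, pairing the row equations with the conjugate
    of \<open>u\<close> produces \<open>cnj (s e)\<close>, so each edge term becomes
    \<open>x e\<close> times a squared modulus.\<close>
  have cnj_s: "cnj (s e) = (\<Sum>i<n. cnj (u $ i) * v e i)" for e
    using v by (auto simp: s_def Reals_cnj_iff mult.commute intro!: sum.cong)
  have "0 = (\<Sum>i<n. cnj (u $ i) * (u $ i + (\<Sum>e\<in>E. x e * v e i * s e)))"
    by (simp add: row)
  also have "\<dots> = (\<Sum>i<n. cnj (u $ i) * u $ i) + (\<Sum>i<n. \<Sum>e\<in>E. x e * s e * (cnj (u $ i) * v e i))"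
    by (simp add: distrib_left sum.distrib sum_distrib_left ac_simps)
  also have "(\<Sum>i<n. \<Sum>e\<in>E. x e * s e * (cnj (u $ i) * v e i)) = (\<Sum>e\<in>E. x e * s e * cnj (s e))"
    by (subst sum.swap) (simp add: cnj_s sum_distrib_left)
  also have "(\<Sum>i<n. cnj (u $ i) * u $ i) = of_real (\<Sum>i<n. (cmod (u $ i))\<^sup>2)"
    unfolding of_real_sum by (intro sum.cong refl) (metis complex_norm_square mult.commute)
  also have "(\<Sum>e\<in>E. x e * s e * cnj (s e)) = (\<Sum>e\<in>E. x e * of_real ((cmod (s e))\<^sup>2))"
    by (intro sum.cong refl) (metis complex_norm_square mult.assoc)
  finally have eq: "of_real (\<Sum>i<n. (cmod (u $ i))\<^sup>2) + (\<Sum>e\<in>E. x e * of_real ((cmod (s e))\<^sup>2)) = 0"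
    by simp
  \<comment> \<open>The norm of \<open>u\<close> is real and drops out; what remains is a vanishing
    sum of nonnegative terms.\<close>
  from arg_cong[OF eq, of Im] have "(\<Sum>e\<in>E. Im (x e) * (cmod (s e))\<^sup>2) = 0"
    by (simp flip: of_real_power)
  moreover have "0 \<le> Im (x e) * (cmod (s e))\<^sup>2" if "e \<in> E" for e
    using x[OF that] by simp
  ultimately have "\<forall>e\<in>E. Im (x e) * (cmod (s e))\<^sup>2 = 0"
    using \<open>finite E\<close> by (simp add: sum_nonneg_eq_0_iff)
  hence "\<forall>e\<in>E. s e = 0" using x by fastforce
  hence "u $ i = 0" if "i < n" for i using row[OF that] by simp
  hence "u = 0\<^sub>v n" using u(1) by (intro eq_vecI) auto
  with u(2) show False by simp
qed

subsection \<open>Acyclic edge sets\<close>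

definition adjacent :: "('e \<Rightarrow> 'v set) \<Rightarrow> 'e set \<Rightarrow> ('v \<times> 'v) set" where
  "adjacent ends F = {(u, v). \<exists>e\<in>F. ends e = {u, v}}"

lemma adjacent_insert:
  "ends e = {a, b} \<Longrightarrow> adjacent ends (insert e F) = insert (a, b) (insert (b, a) (adjacent ends F))"
  by (auto simp: adjacent_def doubleton_eq_iff)

lemma sym_adjacent: "sym (adjacent ends F)"
  by (auto simp: adjacent_def sym_def insert_commute)

lemma connected_rel_adjacent: "connected_rel V ends F = (adjacent ends F)\<^sup>* \<inter> V \<times> V"
  by (simp add: connected_rel_def adjacent_def)

text \<open>A route can be shortened until it crosses the new edge at most once, in one of the two
  directions.\<close>

lemma connected_rel_insert:
  assumes "ends e = {a, b}" "a \<in> V" "b \<in> V"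
  shows "(u, v) \<in> connected_rel V ends (insert e F) \<longleftrightarrow>
    (u, v) \<in> connected_rel V ends F \<or>
    (u, a) \<in> connected_rel V ends F \<and> (b, v) \<in> connected_rel V ends F \<or>
    (u, b) \<in> connected_rel V ends F \<and> (a, v) \<in> connected_rel V ends F"
proof -
  let ?R = "adjacent ends F"
  have s: "(q, p) \<in> ?R\<^sup>*" if "(p, q) \<in> ?R\<^sup>*" for p q
    using sym_rtrancl[OF sym_adjacent] that by (rule symD)
  have "(u, v) \<in> (adjacent ends (insert e F))\<^sup>* \<longleftrightarrow> (u, v) \<in> ?R\<^sup>* \<or>
    (u, a) \<in> ?R\<^sup>* \<and> (b, v) \<in> ?R\<^sup>* \<or> (u, b) \<in> ?R\<^sup>* \<and> (a, v) \<in> ?R\<^sup>*"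
    unfolding adjacent_insert[of ends e a b, OF assms(1)] rtrancl_insert
    by (simp) (meson s rtrancl_trans)
  thus ?thesis using assms(2,3) by (auto simp: connected_rel_adjacent)
qed

text \<open>Supplies the distinct vertices that \<open>is_cycle\<close> demands. An edge is
  prepended to the path, and if its new end already lies on the path, only the tail from there is
  kept.\<close>

lemma simple_path:
  assumes "(x, y) \<in> (adjacent ends F)\<^sup>*"
  shows "\<exists>vs es. length vs = Suc (length es) \<and> distinct vs \<and> vs ! 0 = x \<and> last vs = y \<and>
    set es \<subseteq> F \<and> (\<forall>i<length es. ends (es ! i) = {vs ! i, vs ! Suc i})"
  using assms
proof (induction rule: converse_rtrancl_induct)
  case base
  show ?case by (intro exI[of _ "[y]"] exI[of _ "[]"]) auto
next
  case (step x z)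
  then obtain vs es where p: "length vs = Suc (length es)" "distinct vs" "vs ! 0 = z" "last vs = y"
    "set es \<subseteq> F" "\<And>i. i < length es \<Longrightarrow> ends (es ! i) = {vs ! i, vs ! Suc i}" by blast
  from step obtain f where f: "f \<in> F" "ends f = {x, z}" by (auto simp: adjacent_def)
  show ?case
  proof (cases "x \<in> set vs")
    case True
    then obtain k where k: "k < length vs" "vs ! k = x" by (auto simp: in_set_conv_nth)
    have "set (drop k es) \<subseteq> F" using p(5) set_drop_subset by fastforce
    thus ?thesis using p k
      by (intro exI[of _ "drop k vs"] exI[of _ "drop k es"]) auto
  next
    case False
    have "ends ((f # es) ! i) = {(x # vs) ! i, (x # vs) ! Suc i}" if "i < length (f # es)" for i
      using that p f by (cases i) auto
    thus ?thesis using p False f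
      by (intro exI[of _ "x # vs"] exI[of _ "f # es"]) auto
  qed
qed

definition acyclic_edges :: "('e \<Rightarrow> 'v set) \<Rightarrow> 'e set \<Rightarrow> bool" where
  "acyclic_edges ends F \<longleftrightarrow> (\<nexists>vs es. is_cycle ends F vs es)"

lemma acyclic_edges_mono: "acyclic_edges ends G \<Longrightarrow> F \<subseteq> G \<Longrightarrow> acyclic_edges ends F"
  unfolding acyclic_edges_def is_cycle_def by (meson order_trans)

lemma cycle_if_connected:
  assumes e: "ends e = {a, b}" "a \<noteq> b" "e \<notin> F" and ab: "(a, b) \<in> (adjacent ends F)\<^sup>*"
  shows "\<exists>vs es. is_cycle ends (insert e F) vs es"
proof -
  obtain vs es where p: "length vs = Suc (length es)" "distinct vs" "vs ! 0 = a" "last vs = b"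
    "set es \<subseteq> F" "\<And>i. i < length es \<Longrightarrow> ends (es ! i) = {vs ! i, vs ! Suc i}"
    using simple_path[OF ab] by blast
  have "distinct es"
    unfolding distinct_conv_nth
  proof (intro allI impI)
    fix i j assume ij: "i < length es" "j < length es" "i \<noteq> j"
    \<comment> \<open>Equality would force \<open>i = j\<close>, or both \<open>i = Suc j\<close>
      and \<open>j = Suc i\<close>, since the vertices are distinct.\<close>
    have "{vs ! i, vs ! Suc i} \<noteq> {vs ! j, vs ! Suc j}"
      using ij p(1,2) by (auto simp: doubleton_eq_iff nth_eq_iff_index_eq)
    thus "es ! i \<noteq> es ! j" using p(6) ij by metis
  qed
  moreover have "vs ! length es = b" using p(1,4) by (metis diff_Suc_1 last_conv_nth list.size(3) nat.simps(3))
  moreover have "ends ((es @ [e]) ! i) = {vs ! i, vs ! (Suc i mod Suc (length es))}"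
    if "i < Suc (length es)" for i
  proof (cases "i = length es")
    case True
    thus ?thesis using p(3) e(1) \<open>vs ! length es = b\<close> by (simp add: insert_commute)
  next
    case False
    hence "i < length es" using that by simp
    thus ?thesis using p(6) by (simp add: nth_append)
  qed
  ultimately have "is_cycle ends (insert e F) vs (es @ [e])"
    using p(1,2,5) e(3) unfolding is_cycle_def by auto
  thus ?thesis by blast
qed

text \<open>Removing \<open>e\<close> from the cycle leaves a walk around the remaining edges from
  one end of \<open>e\<close> to the other.\<close>

lemma connected_if_cycle:
  assumes e: "ends e = {a, b}" and c: "is_cycle ends (insert e F) vs es" and "e \<in> set es"
  shows "(a, b) \<in> (adjacent ends F)\<^sup>*"
proof -
  define m where "m = length es"
  have c: "length vs = m" "distinct es" "set es \<subseteq> insert e F"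
      "\<And>i. i < m \<Longrightarrow> ends (es ! i) = {vs ! i, vs ! (Suc i mod m)}"
    using c by (auto simp: is_cycle_def m_def)
  obtain k where k: "k < m" "es ! k = e" using assms(3) by (auto simp: in_set_conv_nth m_def)
  have walk: "t < m \<Longrightarrow> (vs ! (Suc k mod m), vs ! ((Suc k + t) mod m)) \<in> (adjacent ends F)\<^sup>*" for t
  proof (induction t)
    case (Suc t)
    define j where "j = (Suc k + t) mod m"
    have "j < m" using k by (simp add: j_def)
    \<comment> \<open>Position \<open>Suc k + t\<close> returns to \<open>k\<close> modulo
      \<open>m\<close> only when \<open>m\<close> divides \<open>Suc t\<close>, and here
      \<open>Suc t < m\<close>; so the walk has not yet reached \<open>e\<close>.\<close>
    have "j \<noteq> k" using k Suc.prems by (auto simp: j_def mod_if split: if_splits)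
    hence "es ! j \<in> F" using c(2,3) k \<open>j < m\<close> by (metis insertE m_def nth_eq_iff_index_eq nth_mem subsetD)
    moreover have "Suc j mod m = (Suc k + Suc t) mod m" by (simp add: j_def mod_Suc_eq)
    ultimately have "(vs ! j, vs ! ((Suc k + Suc t) mod m)) \<in> adjacent ends F"
      using c(4)[OF \<open>j < m\<close>] by (auto simp: adjacent_def)
    thus ?case using Suc by (simp add: j_def)
  qed simp
  have "(Suc k + (m - 1)) mod m = k" using k by simp
  with walk[of "m - 1"] k have w: "(vs ! (Suc k mod m), vs ! k) \<in> (adjacent ends F)\<^sup>*" by simp
  have "{a, b} = {vs ! k, vs ! (Suc k mod m)}" using c(4)[OF k(1)] k e by simp
  thus ?thesis using w symD[OF sym_rtrancl[OF sym_adjacent] w] by (auto simp: doubleton_eq_iff)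
qed

text \<open>Kruskal's criterion. A cycle that avoids \<open>e\<close> already lies in
  \<open>F\<close>; one through \<open>e\<close> amounts to a connection of its ends inside
  \<open>F\<close>.\<close>

lemma acyclic_edges_insert:
  assumes "ends e = {a, b}" "a \<noteq> b" "e \<notin> F"
  shows "acyclic_edges ends (insert e F) \<longleftrightarrow> acyclic_edges ends F \<and> (a, b) \<notin> (adjacent ends F)\<^sup>*"
proof -
  have "is_cycle ends F vs es" if "is_cycle ends (insert e F) vs es" "e \<notin> set es" for vs es
    using that by (auto simp: is_cycle_def)
  hence "(a, b) \<in> (adjacent ends F)\<^sup>*" if "\<not> acyclic_edges ends (insert e F)" "acyclic_edges ends F"
    using that connected_if_cycle[of ends e a b F, OF assms(1)] unfolding acyclic_edges_def by metis
  moreover have "acyclic_edges ends F" if "acyclic_edges ends (insert e F)"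
    using that by (rule acyclic_edges_mono) (rule subset_insertI)
  moreover note cycle_if_connected[of ends e a b F, OF assms]
  ultimately show ?thesis unfolding acyclic_edges_def by argo
qed

text \<open>The components are the fibres of \<open>\<pi>\<close>. Fibres over the image are
  nonempty, so distinct labels give distinct components and the product can run over labels.\<close>

lemma forest_weight_fibres:
  assumes V: "finite V" and \<pi>: "\<And>u v. u \<in> V \<Longrightarrow> v \<in> V \<Longrightarrow> \<pi> u = \<pi> v \<longleftrightarrow> (u, v) \<in> connected_rel V ends F"
  shows "forest_weight V ends F = (\<Prod>i\<in>\<pi> ` V. card {u \<in> V. \<pi> u = i})"
proof -
  let ?g = "\<lambda>i. {u \<in> V. \<pi> u = i}"
  have cls: "connected_rel V ends F `` {u} = ?g (\<pi> u)" if "u \<in> V" for u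
    using that \<pi>[of u] by (auto simp: connected_rel_adjacent eq_commute[of _ "\<pi> u"])
  have "components V ends F = ?g ` \<pi> ` V"
    unfolding components_def quotient_def image_image using cls by auto
  moreover have "inj_on ?g (\<pi> ` V)" by (auto simp: inj_on_def)
  ultimately show ?thesis by (simp add: forest_weight_def prod.reindex)
qed

subsection \<open>Evaluation of multiaffine polynomials\<close>

text \<open>Cancellation may shrink the support of a sum, so additivity needs one index set shared
  by \<open>p\<close>, \<open>q\<close> and \<open>p + q\<close>.\<close>

lemma poly_eval_superset:
  assumes "finite A" "Poly_Mapping.keys p \<subseteq> A"
  shows "poly_eval x p = (\<Sum>m\<in>A. Poly_Mapping.lookup p m *
        (\<Prod>v\<in>Poly_Mapping.keys m. x v ^ Poly_Mapping.lookup m v))"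
  unfolding poly_eval_def using assms
  by (intro sum.mono_neutral_left) (auto simp: in_keys_iff)

lemma poly_eval_add: "poly_eval x (p + q) = poly_eval x p + poly_eval x q"
proof -
  let ?A = "Poly_Mapping.keys p \<union> Poly_Mapping.keys q"
  have "Poly_Mapping.keys (p + q) \<subseteq> ?A" by (rule Poly_Mapping.keys_add)
  thus ?thesis
    by (simp add: poly_eval_superset[of ?A] lookup_add distrib_right sum.distrib)
qed

lemma poly_eval_sum: "poly_eval x (\<Sum>i\<in>I. p i) = (\<Sum>i\<in>I. poly_eval x (p i))"
  by (induction I rule: infinite_finite_induct) (simp_all add: poly_eval_add, simp_all add: poly_eval_def)

definition set_monom :: "'v set \<Rightarrow> 'v \<Rightarrow>\<^sub>0 nat" where
  "set_monom F = (\<Sum>e\<in>F. Poly_Mapping.single e 1)"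

lemma lookup_set_monom: "finite F \<Longrightarrow> Poly_Mapping.lookup (set_monom F) e = of_bool (e \<in> F)"
  by (auto simp: set_monom_def lookup_sum lookup_single when_def if_distrib cong: if_cong)

lemma keys_set_monom: "finite F \<Longrightarrow> Poly_Mapping.keys (set_monom F) = F"
  by (auto simp: in_keys_iff lookup_set_monom)

lemma of_nat_times_prod_Var:
  "finite F \<Longrightarrow> of_nat c * (\<Prod>e\<in>F. Var e) = Poly_Mapping.single (set_monom F) (of_nat c)"
proof -
  assume "finite F"
  hence "(\<Prod>e\<in>F. Var e) = Poly_Mapping.single (set_monom F) (1 :: complex)"
    by induction (auto simp: set_monom_def Var_def mult_single)
  thus ?thesis by (simp flip: single_of_nat add: mult_single)
qed

lemma poly_eval_set_monom:
  assumes "finite F"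
  shows "poly_eval x (Poly_Mapping.single (set_monom F) c) = c * (\<Prod>e\<in>F. x e)"
  using assms by (simp add: poly_eval_superset[of "{set_monom F}"] keys_set_monom lookup_set_monom)

subsection \<open>The forest expansion\<close>

text \<open>\<open>a\<close> and \<open>b\<close> orient each edge. An edge that contraction by
  \<open>\<pi>\<close> turns into a loop gets the zero vector and so drops out of
  \<open>gram_mat\<close>.\<close>

definition incidence :: "('e \<Rightarrow> 'v) \<Rightarrow> ('e \<Rightarrow> 'v) \<Rightarrow> ('v \<Rightarrow> nat) \<Rightarrow> 'e \<Rightarrow> nat \<Rightarrow> 'a::comm_ring_1" where
  "incidence a b \<pi> e i = of_bool (i = \<pi> (a e)) - of_bool (i = \<pi> (b e))"

text \<open>Contractions are encoded without changing the matrix size: \<open>\<pi>\<close> sends each vertex to the index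
  of its contracted vertex, and an index that is no longer in use gets diagonal entry 1.\<close>

definition fibre_card :: "'v set \<Rightarrow> ('v \<Rightarrow> nat) \<Rightarrow> nat \<Rightarrow> 'a::comm_ring_1" where
  "fibre_card V \<pi> i = (if i \<in> \<pi> ` V then of_nat (card {u \<in> V. \<pi> u = i}) else 1)"

definition merge_fibres :: "nat \<Rightarrow> nat \<Rightarrow> ('v \<Rightarrow> nat) \<Rightarrow> 'v \<Rightarrow> nat" where
  "merge_fibres s t \<pi> u = (if \<pi> u = t then s else \<pi> u)"

text \<open>Relabelling \<open>t\<close> as \<open>s\<close> reproduces the vector update of
  \<open>det_gram_mat_insert\<close>; \<open>fibre_card_merge\<close> does the same for the
  diagonal.\<close>

lemma incidence_merge:
  assumes "s \<noteq> t"
  shows "incidence a b (merge_fibres s t \<pi>) e =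
    (incidence a b \<pi> e)(s := incidence a b \<pi> e s + incidence a b \<pi> e t, t := 0)"
  using assms by (intro ext) (auto simp: incidence_def merge_fibres_def)

lemma fibre_card_merge:
  assumes "finite V" "s \<in> \<pi> ` V" "t \<in> \<pi> ` V" "s \<noteq> t"
  shows "fibre_card V (merge_fibres s t \<pi>) =
    (fibre_card V \<pi>)(s := fibre_card V \<pi> s + fibre_card V \<pi> t, t := 1)"
proof
  fix i
  have "{u \<in> V. merge_fibres s t \<pi> u = s} = {u \<in> V. \<pi> u = s} \<union> {u \<in> V. \<pi> u = t}"
    by (auto simp: merge_fibres_def)
  hence s: "card {u \<in> V. merge_fibres s t \<pi> u = s} = card {u \<in> V. \<pi> u = s} + card {u \<in> V. \<pi> u = t}"
    using assms by (simp only:) (rule card_Un_disjoint, auto)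
  have eq: "{u \<in> V. merge_fibres s t \<pi> u = i} = {u \<in> V. \<pi> u = i}" if "i \<noteq> s" "i \<noteq> t"
    using that by (auto simp: merge_fibres_def)
  have im: "merge_fibres s t \<pi> ` V = \<pi> ` V - {t}"
    using assms by (auto simp: merge_fibres_def image_iff)
  consider "i = s" | "i = t" | "i \<noteq> s" "i \<noteq> t" by blast
  thus "fibre_card V (merge_fibres s t \<pi>) i =
    ((fibre_card V \<pi>)(s := fibre_card V \<pi> s + fibre_card V \<pi> t, t := 1)) i"
    by cases (use assms in \<open>simp_all add: fibre_card_def im s eq\<close>)
qed

lemma prod_fibre_card:
  assumes "finite V" "\<And>u. u \<in> V \<Longrightarrow> \<pi> u < n"
  shows "(\<Prod>i<n. fibre_card V \<pi> i :: 'a::comm_ring_1) = of_nat (\<Prod>i\<in>\<pi> ` V. card {u \<in> V. \<pi> u = i})"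
proof -
  have "(\<Prod>i<n. fibre_card V \<pi> i :: 'a) = (\<Prod>i\<in>\<pi> ` V. fibre_card V \<pi> i)"
    using assms by (intro prod.mono_neutral_right) (auto simp: fibre_card_def)
  thus ?thesis by (simp add: fibre_card_def)
qed

text \<open>\<open>C\<close> is the set of edges already contracted, and \<open>\<pi>\<close> labels its components.\<close>

lemma det_gram_mat_forest_expansion:
  fixes w :: "'e \<Rightarrow> 'a::comm_ring_1"
  assumes "finite V" "finite E"
    and "\<And>e. e \<in> E \<Longrightarrow> ends e = {a e, b e} \<and> a e \<noteq> b e \<and> a e \<in> V \<and> b e \<in> V"
    and "C \<inter> E = {}" "acyclic_edges ends C"
    and "\<And>u. u \<in> V \<Longrightarrow> \<pi> u < n"
    and "\<And>u v. u \<in> V \<Longrightarrow> v \<in> V \<Longrightarrow> \<pi> u = \<pi> v \<longleftrightarrow> (u, v) \<in> connected_rel V ends C"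
  shows "det (gram_mat n (fibre_card V \<pi>) E w (incidence a b \<pi>)) =
    (\<Sum>F\<in>Pow E. if acyclic_edges ends (C \<union> F)
       then of_nat (forest_weight V ends (C \<union> F)) * (\<Prod>e\<in>F. w e) else 0)"
  using assms(2-)
proof (induction E arbitrary: C \<pi> rule: finite_induct)
  case empty
  have "forest_weight V ends C = (\<Prod>i\<in>\<pi> ` V. card {u \<in> V. \<pi> u = i})"
    using assms(1) empty.prems(5) by (rule forest_weight_fibres)
  thus ?case
    using empty.prems(3) by (simp add: det_gram_mat_empty
      prod_fibre_card[of V \<pi> n, OF assms(1) empty.prems(4)] del: of_nat_prod)
next
  case (insert e E)
  let ?g = "\<lambda>C F. if acyclic_edges ends (C \<union> F)
       then of_nat (forest_weight V ends (C \<union> F)) * (\<Prod>e\<in>F. w e) else 0"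
  let ?s = "\<pi> (a e)" and ?t = "\<pi> (b e)"
  have e: "ends e = {a e, b e}" "a e \<noteq> b e" "a e \<in> V" "b e \<in> V" "e \<notin> C" using insert.prems by auto
  \<comment> \<open>Subsets are sorted by whether they contain \<open>e\<close>; in those that do,
    \<open>e\<close> moves over to \<open>C\<close> and leaves the factor
    \<open>w e\<close>.\<close>
  have split: "(\<Sum>F\<in>Pow (insert e E). ?g C F) =
      (\<Sum>F\<in>Pow E. ?g C F) + w e * (\<Sum>F\<in>Pow E. ?g (insert e C) F)"
  proof -
    have "inj_on (insert e) (Pow E)" using insert.hyps(2) by (auto simp: inj_on_def)
    hence "(\<Sum>F\<in>insert e ` Pow E. ?g C F) = (\<Sum>F\<in>Pow E. ?g C (insert e F))"
      by (simp add: sum.reindex)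
    also have "\<dots> = (\<Sum>F\<in>Pow E. w e * ?g (insert e C) F)"
    proof (intro sum.cong refl)
      fix F assume "F \<in> Pow E"
      hence "finite F" "e \<notin> F" using insert.hyps by (auto dest: finite_subset)
      thus "?g C (insert e F) = w e * ?g (insert e C) F" by (simp add: mult_ac)
    qed
    also have "\<dots> = w e * (\<Sum>F\<in>Pow E. ?g (insert e C) F)" by (simp only: sum_distrib_left)
    finally show ?thesis
      using insert.hyps unfolding Pow_insert by (subst sum.union_disjoint) auto
  qed
  have IH1: "det (gram_mat n (fibre_card V \<pi>) E w (incidence a b \<pi>)) = (\<Sum>F\<in>Pow E. ?g C F)"
    using insert.prems by (intro insert.IH) auto
  have conn: "(a e, b e) \<in> (adjacent ends C)\<^sup>* \<longleftrightarrow> ?s = ?t"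
    using e insert.prems(5)[of "a e" "b e"] by (auto simp: connected_rel_adjacent)
  show ?case
  proof (cases "?s = ?t")
    \<comment> \<open>The ends are already connected: every set containing \<open>e\<close> and
      \<open>C\<close> has a cycle, and the vector of \<open>e\<close> is zero, so \<open>e\<close>
      contributes to neither side.\<close>
    case True
    hence "\<not> acyclic_edges ends (insert e C)"
      using conn acyclic_edges_insert[of ends e "a e" "b e" C, OF e(1,2,5)] by blast
    hence "?g (insert e C) F = 0" for F
      using acyclic_edges_mono[of ends "insert e C \<union> F" "insert e C"] by (auto simp del: Un_insert_left)
    hence "(\<Sum>F\<in>Pow E. ?g (insert e C) F) = 0" by (intro sum.neutral) blast
    moreover have "gram_mat n (fibre_card V \<pi>) (insert e E) w (incidence a b \<pi>) =
        gram_mat n (fibre_card V \<pi>) E w (incidence a b \<pi>)"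
      using True insert.hyps by (simp add: gram_mat_def incidence_def)
    ultimately show ?thesis using IH1 split by simp
  next
    case False
    let ?\<pi> = "merge_fibres ?s ?t \<pi>"
    have "det (gram_mat n (fibre_card V ?\<pi>) E w (incidence a b ?\<pi>)) = (\<Sum>F\<in>Pow E. ?g (insert e C) F)"
    proof (intro insert.IH)
      show "acyclic_edges ends (insert e C)"
        using insert.prems(3) False conn acyclic_edges_insert[of ends e "a e" "b e" C, OF e(1,2,5)] by blast
      \<comment> \<open>Inserting \<open>e\<close> unites exactly the classes labelled
        \<open>?s\<close> and \<open>?t\<close>.\<close>
      show "?\<pi> u = ?\<pi> v \<longleftrightarrow> (u, v) \<in> connected_rel V ends (insert e C)" if "u \<in> V" "v \<in> V" for u v
        unfolding connected_rel_insert[of ends e "a e" "b e" V u v C, OF e(1,3,4)]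
        using that e(3,4) insert.prems(5)[symmetric] by (auto simp: merge_fibres_def)
    qed (use insert e in \<open>auto simp: merge_fibres_def\<close>)
    moreover have "det (gram_mat n (fibre_card V \<pi>) (insert e E) w (incidence a b \<pi>)) =
        det (gram_mat n (fibre_card V \<pi>) E w (incidence a b \<pi>)) +
        w e * det (gram_mat n (fibre_card V ?\<pi>) E w (incidence a b ?\<pi>))"
    proof -
      have m: "incidence a b ?\<pi> = (\<lambda>f. (incidence a b \<pi> f :: nat \<Rightarrow> 'a)
          (?s := incidence a b \<pi> f ?s + incidence a b \<pi> f ?t, ?t := 0))"
        by (rule ext) (rule incidence_merge[OF False])
      show ?thesis
        unfolding m
        by (subst fibre_card_merge, (use assms(1) e False in auto)[4], rule det_gram_mat_insert)
          (use insert.hyps insert.prems(4) e False in \<open>auto simp: incidence_def\<close>)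
    qed
    ultimately show ?thesis using IH1 split by simp
  qed
qed

lemma det_forest_expansion:
  fixes w :: "'e \<Rightarrow> 'a::comm_ring_1" and a b :: "'e \<Rightarrow> nat"
  assumes "finite E"
    and ends: "\<And>e. e \<in> E \<Longrightarrow> ends e = {a e, b e} \<and> a e \<noteq> b e \<and> a e \<in> {1..n} \<and> b e \<in> {1..n}"
  shows "det (gram_mat n (\<lambda>_. 1) E w (incidence a b (\<lambda>u. u - 1))) =
    (\<Sum>F\<in>spanning_forests E ends. of_nat (forest_weight {1..n} ends F) * (\<Prod>e\<in>F. w e))"
proof -
  \<comment> \<open>The shift from vertices to matrix indices. Nothing is contracted yet, so all
    fibres are singletons and the diagonal is that of the identity.\<close>
  let ?\<pi> = "\<lambda>u :: nat. u - 1"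
  have fc: "fibre_card {1..n} ?\<pi> = (\<lambda>_. 1 :: 'a)"
  proof
    fix i
    have "{u \<in> {1..n}. u - 1 = i} = (if i < n then {Suc i} else {})" by auto
    moreover have "?\<pi> ` {1..n} = {..<n}"
      by (auto simp: image_iff intro!: bexI[of _ "Suc _"])
    ultimately show "fibre_card {1..n} ?\<pi> i = (1 :: 'a)" by (simp add: fibre_card_def)
  qed
  have "det (gram_mat n (fibre_card {1..n} ?\<pi>) E w (incidence a b ?\<pi>)) =
    (\<Sum>F\<in>Pow E. if acyclic_edges ends ({} \<union> F)
       then of_nat (forest_weight {1..n} ends ({} \<union> F)) * (\<Prod>e\<in>F. w e) else 0)"
    by (rule det_gram_mat_forest_expansion)
      (use assms in \<open>auto simp: connected_rel_def acyclic_edges_def is_cycle_def\<close>)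
  also have "\<dots> = (\<Sum>F\<in>spanning_forests E ends. of_nat (forest_weight {1..n} ends F) * (\<Prod>e\<in>F. w e))"
    using \<open>finite E\<close> by (intro sum.mono_neutral_cong_right) (auto simp: spanning_forests_def acyclic_edges_def)
  finally show ?thesis by (simp only: fc)
qed

text \<open>Each edge matrix is the rank-one product of its incidence vector with itself; reversing
  the orientation changes both signs.\<close>

lemma laplacian_gram_mat:
  assumes ends: "\<And>e. e \<in> E \<Longrightarrow> ends e = {a e, b e} \<and> a e \<noteq> b e \<and> a e \<in> {1..n} \<and> b e \<in> {1..n}"
  shows "laplacian n E ends + 1\<^sub>m n = gram_mat n (\<lambda>_. 1) E Var (incidence a b (\<lambda>u. u - 1))"
proof (rule eq_matI)
  fix i j assume "i < dim_row (gram_mat n (\<lambda>_. 1) E Var (incidence a b (\<lambda>u. u - 1)))"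
    "j < dim_col (gram_mat n (\<lambda>_. 1) E Var (incidence a b (\<lambda>u. u - 1)))"
  hence ij: "i < n" "j < n" by (auto simp: gram_mat_def)
  have "edge_mat n (ends e) $$ (i, j) =
      (incidence a b (\<lambda>u. u - 1) e i * incidence a b (\<lambda>u. u - 1) e j :: 'a cpoly)" if e: "e \<in> E" for e
  proof -
    \<comment> \<open>Passing to predecessors removes the truncated subtraction, which is injective
      only on positive vertices.\<close>
    obtain p q where "a e = Suc p" "b e = Suc q" "p \<noteq> q"
      using ends[OF e] by (cases "a e"; cases "b e") auto
    thus ?thesis using ij ends[OF e]
      by (auto simp: edge_mat_def incidence_def doubleton_eq_iff)
  qed
  thus "(laplacian n E ends + 1\<^sub>m n) $$ (i, j) =
      gram_mat n (\<lambda>_. 1) E Var (incidence a b (\<lambda>u. u - 1)) $$ (i, j)"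
    using ij by (simp add: laplacian_def gram_mat_def mult.assoc)
qed (auto simp: gram_mat_def)

theorem theorem3p6:
  fixes n :: nat and E :: "'e set" and ends :: "'e \<Rightarrow> nat set"
  assumes "graph {1..n} E ends"
  shows "graph_poly n E ends (\<lambda>_. 1) = det (laplacian n E ends + 1\<^sub>m n)
    \<and> det (laplacian n E ends + 1\<^sub>m n)
        = (\<Sum>F\<in>spanning_forests E ends.
             of_nat (forest_weight {1..n} ends F) * (\<Prod>e\<in>F. Var e))
    \<and> real_stable E (graph_poly n E ends (\<lambda>_. 1))"
proof -
  let ?c = "\<lambda>F. of_nat (forest_weight {1..n} ends F) :: complex"
  have E: "finite E" using assms by (simp add: graph_def)
  have fin: "finite F" "F \<subseteq> E" if "F \<in> spanning_forests E ends" for F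
    using that finite_subset[OF _ E] by (auto simp: spanning_forests_def)
  have "\<forall>e\<in>E. \<exists>a b. ends e = {a, b} \<and> a \<noteq> b \<and> a \<in> {1..n} \<and> b \<in> {1..n}"
  proof
    fix e assume "e \<in> E"
    hence "ends e \<subseteq> {1..n}" "card (ends e) = 2" using assms by (auto simp: graph_def)
    thus "\<exists>a b. ends e = {a, b} \<and> a \<noteq> b \<and> a \<in> {1..n} \<and> b \<in> {1..n}"
      unfolding card_2_iff by (metis insert_subset)
  qed
  then obtain a b where ends:
      "\<And>e. e \<in> E \<Longrightarrow> ends e = {a e, b e} \<and> a e \<noteq> b e \<and> a e \<in> {1..n} \<and> b e \<in> {1..n}"
    by metis
  have gp: "graph_poly n E ends (\<lambda>_. 1) = det (laplacian n E ends + 1\<^sub>m n)"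
    unfolding graph_poly_def
    by (intro arg_cong[of _ _ det] eq_matI) (auto simp: mat_diag_def laplacian_def)
  have expansion: "det (laplacian n E ends + 1\<^sub>m n) =
      (\<Sum>F\<in>spanning_forests E ends. of_nat (forest_weight {1..n} ends F) * (\<Prod>e\<in>F. Var e))"
    by (subst laplacian_gram_mat[where a = a and b = b], (use ends in auto)[1], rule det_forest_expansion)
      (use E ends in auto)
  also have "\<dots> = (\<Sum>F\<in>spanning_forests E ends. Poly_Mapping.single (set_monom F) (?c F))"
    using fin by (intro sum.cong of_nat_times_prod_Var) auto
  finally have gp': "graph_poly n E ends (\<lambda>_. 1) =
      (\<Sum>F\<in>spanning_forests E ends. Poly_Mapping.single (set_monom F) (?c F))"
    using gp by simp
  \<comment> \<open>Every coefficient is a sum of forest weights, hence real, and a monomial that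
    occurs must come from a forest inside \<open>E\<close>.\<close>
  have lookup: "Poly_Mapping.lookup (graph_poly n E ends (\<lambda>_. 1)) m =
      (\<Sum>F\<in>spanning_forests E ends. if set_monom F = m then ?c F else 0)" for m
    by (simp add: gp' lookup_sum lookup_single when_def del: One_nat_def)
  have "Poly_Mapping.keys m \<subseteq> E" if "m \<in> Poly_Mapping.keys (graph_poly n E ends (\<lambda>_. 1))" for m
  proof -
    from that have "(\<Sum>F\<in>spanning_forests E ends. if set_monom F = m then ?c F else 0) \<noteq> 0"
      by (simp add: in_keys_iff lookup del: One_nat_def)
    then obtain F where F: "F \<in> spanning_forests E ends" "set_monom F = m"
      by (rule sum.not_neutral_contains_not_neutral) (auto split: if_splits)
    thus ?thesis using fin[OF F(1)] keys_set_monom[of F] by auto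
  qed
  moreover have "Poly_Mapping.lookup (graph_poly n E ends (\<lambda>_. 1)) m \<in> \<real>" for m
    unfolding lookup by (intro sum_in_Reals) auto
  moreover have "poly_eval x (graph_poly n E ends (\<lambda>_. 1)) \<noteq> 0" if "\<forall>e\<in>E. Im (x e) > 0" for x
  proof -
    have "poly_eval x (graph_poly n E ends (\<lambda>_. 1)) =
        (\<Sum>F\<in>spanning_forests E ends. ?c F * (\<Prod>e\<in>F. x e))"
      unfolding gp' poly_eval_sum by (intro sum.cong poly_eval_set_monom) (auto simp: fin)
    \<comment> \<open>The expansion read backwards with complex weights \<open>x\<close>, in place
      of an argument that evaluation commutes with \<open>det\<close>.\<close>
    also have "\<dots> = det (gram_mat n (\<lambda>_. 1) E x (incidence a b (\<lambda>u. u - 1)))"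
      by (rule det_forest_expansion[symmetric]) (use E ends in auto)
    also have "\<dots> \<noteq> 0"
      using E that by (intro det_gram_mat_nonzero) (auto simp: incidence_def)
    finally show ?thesis .
  qed
  ultimately show ?thesis using gp expansion by (simp add: real_stable_def stable_def del: One_nat_def)
qed

end
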